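(* For every integer $n\ge 5$, the $n\times n$ elephant basis is a $\mathbb{Z}$-basis for $n\times n$ $\mathbb{Z}$-magic squares.
   Context: An $n\times n$ $\mathbb{Z}$-magic square is an $n\times n$ array of integers such that the sum of the entries in every row, every column and each of the two main diagonals is the same. Under entrywise addition these form a $\mathbb{Z}$-module. $\mathbb{Z}$-basis: a linearly independent set of $n\times n$ $\mathbb{Z}$-magic squares is a $\mathbb{Z}$-basis for $n\times n$ $\mathbb{Z}$-magic squares if every $n\times n$ $\mathbb{Z}$-magic square is an integer linear combination of its elements. Elephant basis: for $n\ge5$, the skeleton is the set of the following $n^2-2n$ positions of an $n\times n$ square: all positions of row $1$; all positions of rows $2,\dots,n-2$ except the last one of each row; all positions of row $n-1$ except the second, the $(n-2)$-th and the last. The $n\times n$ elephant basis is formed by the $n^2-2n$ $n\times n$ $\mathbb{Z}$-magic squares that have entry $1$ in one of the positions of the skeleton and entry $0$ in all other positions of the skeleton (one such square for each skeleton position). *)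

theory Defs
  imports Complex_Main "HOL-Library.Function_Algebras"
begin

text \<open>
  Integer squares are functions from 1-based row and column numbers; addition is the pointwise
  addition of \<^theory>\<open>HOL-Library.Function_Algebras\<close>. The entries outside the \<open>n \<times> n\<close> range
  are fixed to be 0, so that equality of functions is equality of \<open>n \<times> n\<close> arrays.
\<close>

type_synonym int_square = "nat \<Rightarrow> nat \<Rightarrow> int"

definition int_scale :: "int \<Rightarrow> int_square \<Rightarrow> int_square" where
  "int_scale c M = (\<lambda>i j. c * M i j)"

global_interpretation int_square: module int_scale
  by standard (auto simp: int_scale_def plus_fun_def fun_eq_iff algebra_simps)

definition magic_squares :: "nat \<Rightarrow> int_square set" where
  "magic_squares n = {M.
     (\<forall>i j. \<not> (i \<in> {1..n} \<and> j \<in> {1..n}) \<longrightarrow> M i j = 0) \<and>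
     (\<exists>s. (\<forall>i\<in>{1..n}. (\<Sum>j=1..n. M i j) = s) \<and>
          (\<forall>j\<in>{1..n}. (\<Sum>i=1..n. M i j) = s) \<and>
          (\<Sum>i=1..n. M i i) = s \<and>
          (\<Sum>i=1..n. M i (n + 1 - i)) = s)}"

definition is_Z_basis :: "nat \<Rightarrow> int_square set \<Rightarrow> bool" where
  "is_Z_basis n B \<longleftrightarrow>
     B \<subseteq> magic_squares n \<and> int_square.independent B \<and> magic_squares n \<subseteq> int_square.span B"

definition skeleton :: "nat \<Rightarrow> (nat \<times> nat) set" where
  "skeleton n =
     {1} \<times> {1..n} \<union>
     {2..n - 2} \<times> ({1..n} - {n}) \<union>
     {n - 1} \<times> ({1..n} - {2, n - 2, n})"

text \<open>
  If this set is a \<open>\<int>\<close>-basis, then each skeleton position contributes exactly one square to it: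
  two squares for the same position would yield a linear dependence, and a position without
  a square would be 0 in the whole span, which contains the all-ones square.
\<close>

definition elephant_basis :: "nat \<Rightarrow> int_square set" where
  "elephant_basis n = {M \<in> magic_squares n.
     \<exists>(i, j) \<in> skeleton n. M i j = 1 \<and> (\<forall>(k, l) \<in> skeleton n - {(i, j)}. M k l = 0)}"

end

theory Submission imports Defs begin

text \<open>
  A magic square can be read off from its entries on the skeleton, and those entries can be
  prescribed freely. Indeed row 1 fixes the common sum \<open>s\<close>, and afterwards the remaining entries can be
  ordered such that each of them completes a line all of whose other entries are already known:
  the entries of the last column in rows \<open>2..n - 2\<close> (by their rows), the entries of the last row in
  all columns other than \<open>2\<close>, \<open>n - 2\<close>, \<open>n\<close> (by their columns), \<open>(n - 1, 2)\<close> (by the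
  antidiagonal), \<open>(n, 2)\<close> (by column \<open>2\<close>), \<open>(n, n)\<close> (by the main diagonal), \<open>(n - 1, n)\<close> (by the
  last column), \<open>(n - 1, n - 2)\<close> (by row \<open>n - 1\<close>) and \<open>(n, n - 2)\<close> (by column \<open>n - 2\<close>). This uses
  every line except the last row, whose sum is correct because the sum of all rows equals
  the sum of all columns. No division occurs, so everything works over \<open>\<int>\<close>.

  Thus restriction to the skeleton is injective on magic squares
  (\<open>magic_square_eq_0_if_zero_on_skeleton\<close>) and surjective onto all integer patterns on the skeleton
  (\<open>magic_square_with_prescribed_skeleton\<close>). The elephant basis is the preimage of the standard
  basis under this isomorphism.
\<close>

section \<open>Magic squares as a module\<close>

definition magic_with_sum :: "nat \<Rightarrow> int \<Rightarrow> int_square \<Rightarrow> bool" where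
  "magic_with_sum n s M \<longleftrightarrow>
     (\<forall>i j. \<not> (i \<in> {1..n} \<and> j \<in> {1..n}) \<longrightarrow> M i j = 0) \<and>
     (\<forall>i\<in>{1..n}. (\<Sum>j=1..n. M i j) = s) \<and>
     (\<forall>j\<in>{1..n}. (\<Sum>i=1..n. M i j) = s) \<and>
     (\<Sum>i=1..n. M i i) = s \<and>
     (\<Sum>i=1..n. M i (n + 1 - i)) = s"

lemma mem_magic_squares_iff: "M \<in> magic_squares n \<longleftrightarrow> (\<exists>s. magic_with_sum n s M)"
  by (auto simp: magic_squares_def magic_with_sum_def)

lemma subspace_magic_squares: "int_square.subspace (magic_squares n)"
proof (rule int_square.subspaceI)
  have "magic_with_sum n 0 0"
    by (simp add: magic_with_sum_def)
  then show "0 \<in> magic_squares n"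
    by (auto simp: mem_magic_squares_iff)
next
  fix x y assume "x \<in> magic_squares n" "y \<in> magic_squares n"
  then obtain s t where "magic_with_sum n s x" "magic_with_sum n t y"
    by (auto simp: mem_magic_squares_iff)
  then have "magic_with_sum n (s + t) (x + y)"
    by (simp add: magic_with_sum_def sum.distrib)
  then show "x + y \<in> magic_squares n"
    by (auto simp: mem_magic_squares_iff)
next
  fix c x assume "x \<in> magic_squares n"
  then obtain s where "magic_with_sum n s x"
    by (auto simp: mem_magic_squares_iff)
  then have "magic_with_sum n (c * s) (int_scale c x)"
    by (simp add: magic_with_sum_def int_scale_def flip: sum_distrib_left)
  then show "int_scale c x \<in> magic_squares n"
    by (auto simp: mem_magic_squares_iff)
qed

lemma sum_int_square_apply:
  fixes F :: "'a \<Rightarrow> int_square"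
  shows "(\<Sum>x\<in>A. F x) i j = (\<Sum>x\<in>A. F x i j)"
  by (induction A rule: infinite_finite_induct) auto

section \<open>The skeleton determines a magic square\<close>

lemma term_eq_0_if_others_eq_0:
  fixes g :: "'a \<Rightarrow> 'b::comm_monoid_add"
  assumes "sum g A = 0" "finite A" "a \<in> A" "\<And>x. x \<in> A \<Longrightarrow> x \<noteq> a \<Longrightarrow> g x = 0"
  shows "g a = 0"
proof -
  have "sum g A = g a + sum g (A - {a})"
    using assms(2,3) by (rule sum.remove)
  also have "sum g (A - {a}) = 0"
    using assms(4) by (intro sum.neutral) auto
  finally show ?thesis
    using assms(1) by simp
qed

lemma skeleton_iff:
  assumes "n \<ge> 5"
  shows "(i, j) \<in> skeleton n \<longleftrightarrow> i \<in> {1..n} \<and> j \<in> {1..n} \<and>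
    (i = 1 \<or> i \<le> n - 2 \<and> j \<noteq> n \<or> i = n - 1 \<and> j \<noteq> 2 \<and> j \<noteq> n - 2 \<and> j \<noteq> n)"
  using assms unfolding skeleton_def by auto

text \<open>
  The entries off the skeleton vanish one after the other, each because it is alone on a line
  with sum \<open>0\<close>.
\<close>

lemma magic_square_eq_0_if_zero_on_skeleton:
  assumes n: "n \<ge> 5" and M: "M \<in> magic_squares n"
    and zero: "\<And>i j. (i, j) \<in> skeleton n \<Longrightarrow> M i j = 0"
  shows "M = 0"
proof -
  obtain s where s: "magic_with_sum n s M"
    using M by (auto simp: mem_magic_squares_iff)
  have out: "M i j = 0" if "\<not> (i \<in> {1..n} \<and> j \<in> {1..n})" for i j
    using s that unfolding magic_with_sum_def by blast
  have skel: "M i j = 0"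
    if "i \<in> {1..n}" "j \<in> {1..n}"
      "i = 1 \<or> i \<le> n - 2 \<and> j \<noteq> n \<or> i = n - 1 \<and> j \<noteq> 2 \<and> j \<noteq> n - 2 \<and> j \<noteq> n" for i j
    using that n by (intro zero) (simp add: skeleton_iff)
  have "(\<Sum>j=1..n. M 1 j) = 0"
    using skel by (intro sum.neutral) auto
  moreover have "(\<Sum>j=1..n. M 1 j) = s"
    using s n unfolding magic_with_sum_def by auto
  ultimately have s0: "s = 0"
    by simp
  have row: "(\<Sum>j=1..n. M i j) = 0" if "i \<in> {1..n}" for i
    using s that by (simp add: magic_with_sum_def s0)
  have col: "(\<Sum>i=1..n. M i j) = 0" if "j \<in> {1..n}" for j
    using s that by (simp add: magic_with_sum_def s0)
  have diag: "(\<Sum>i=1..n. M i i) = 0" and anti: "(\<Sum>i=1..n. M i (n + 1 - i)) = 0"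
    using s by (simp_all add: magic_with_sum_def s0)
  have last_col: "M i n = 0" if "i \<in> {1..n - 2}" for i
    by (rule term_eq_0_if_others_eq_0[OF row[of i]]) (use that n skel in auto)
  have last_row: "M n j = 0" if "j \<in> {1..n - 1}" "j \<noteq> 2" "j \<noteq> n - 2" for j
  proof (rule term_eq_0_if_others_eq_0[OF col[of j]])
    fix i assume "i \<in> {1..n}" "i \<noteq> n"
    then have "i \<in> {1..n}" "i \<le> n - 2 \<or> i = n - 1"
      by auto
    then show "M i j = 0"
      using that n by (intro skel) auto
  qed (use that n in auto)
  have a: "M (n - 1) 2 = 0"
  proof -
    have "M (n - 1) (n + 1 - (n - 1)) = 0"
    proof (rule term_eq_0_if_others_eq_0[OF anti])
      fix i assume i: "i \<in> {1..n}" "i \<noteq> n - 1"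
      show "M i (n + 1 - i) = 0"
      proof (cases "i = n")
        case True
        then show ?thesis
          using last_row[of 1] n by simp
      next
        case False
        then show ?thesis
          using i n by (intro skel) auto
      qed
    qed (use n in auto)
    moreover have "n + 1 - (n - 1) = 2"
      using n by simp
    ultimately show ?thesis
      by simp
  qed
  have corner: "M n n = 0"
  proof (rule term_eq_0_if_others_eq_0[OF diag])
    fix i assume "i \<in> {1..n}" "i \<noteq> n"
    then have "i \<in> {1..n}" "i \<le> n - 2 \<or> i = n - 1"
      by auto
    then show "M i i = 0"
      using n by (intro skel) auto
  qed (use n in auto)
  have c: "M (n - 1) n = 0"
  proof (rule term_eq_0_if_others_eq_0[OF col[of n]])
    fix i assume "i \<in> {1..n}" "i \<noteq> n - 1"
    then have "i \<in> {1..n - 2} \<or> i = n"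
      by auto
    then show "M i n = 0"
      using last_col corner by auto
  qed (use n in auto)
  have b: "M (n - 1) (n - 2) = 0"
  proof (rule term_eq_0_if_others_eq_0[OF row[of "n - 1"]])
    fix j assume j: "j \<in> {1..n}" "j \<noteq> n - 2"
    show "M (n - 1) j = 0"
      using a c j n skel[of "n - 1" j] by (cases "j = 2 \<or> j = n") auto
  qed (use n in auto)
  have above: "M i j = 0" if "i \<in> {1..n - 1}" "j \<in> {1..n}" for i j
  proof -
    have "i \<in> {1..n - 2} \<or> i = n - 1"
      using that by auto
    then consider "j = n" "i \<in> {1..n - 2}" | "i = n - 1" "j \<in> {2, n - 2, n}"
      | "i \<le> n - 2 \<and> j \<noteq> n \<or> i = n - 1 \<and> j \<noteq> 2 \<and> j \<noteq> n - 2 \<and> j \<noteq> n"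
      by auto
    then show ?thesis
    proof cases
      case 1
      then show ?thesis
        using last_col by simp
    next
      case 2
      then show ?thesis
        using a b c by blast
    next
      case 3
      then show ?thesis
        using that by (intro skel) auto
    qed
  qed
  have bottom: "M n j = 0" if "j \<in> {1..n}" for j
    by (rule term_eq_0_if_others_eq_0[OF col[of j]]) (use that above n in auto)
  have "M i j = 0" for i j
  proof (cases "i \<in> {1..n} \<and> j \<in> {1..n}")
    case True
    then show ?thesis
      using above bottom by (cases "i = n") auto
  qed (use out in blast)
  then show ?thesis
    by (simp add: fun_eq_iff)
qed

section \<open>Every pattern on the skeleton extends to a magic square\<close>

text \<open>
  The pattern \<open>f\<close> is repaired by adding \<open>v\<close> to the last column, \<open>w\<close> to the last row and
  \<open>a\<close>, \<open>b\<close> to the two gaps of row \<open>n - 1\<close>. With \<open>w n = 0\<close> the corner is touched by \<open>v\<close> alone, so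
  that the line sums of the correction are simply read off.
\<close>

lemma magic_square_with_prescribed_skeleton:
  fixes g :: int_square
  assumes n: "n \<ge> 5"
  obtains M where "M \<in> magic_squares n" "\<And>i j. (i, j) \<in> skeleton n \<Longrightarrow> M i j = g i j"
proof -
  define f where "f i j = (if (i, j) \<in> skeleton n then g i j else 0)" for i j
  define s where "s = (\<Sum>j=1..n. f 1 j)"
  define r where "r i = s - (\<Sum>j=1..n. f i j)" for i
  define k where "k j = s - (\<Sum>i=1..n. f i j)" for j
  \<comment> \<open>\<open>a\<close>, \<open>d\<close>, \<open>c\<close>, \<open>b\<close> are what the antidiagonal, the main diagonal, the last column and
    row \<open>n - 1\<close> lack, in this order, as \<open>c\<close> depends on \<open>d\<close>, and \<open>b\<close> on \<open>a\<close> and \<open>c\<close>\<close>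
  define a where "a = s - (\<Sum>i=1..n. f i (n + 1 - i)) - k 1"
  define d where "d = s - (\<Sum>i=1..n. f i i)"
  define c where "c = k n - (\<Sum>i=1..n - 2. r i) - d"
  define b where "b = r (n - 1) - a - c"
  define v where
    "v i = (if i \<in> {1..n - 2} then r i else if i = n - 1 then c else if i = n then d else 0)" for i
  define w where
    "w j = (if j \<in> {1..n - 1} then k j - (if j = 2 then a else 0) - (if j = n - 2 then b else 0)
            else 0)" for j
  define M where
    "M i j = f i j + (if j = n then v i else 0) + (if i = n then w j else 0)
       + (if i = n - 1 then if j = 2 then a else 0 else 0)
       + (if i = n - 1 then if j = n - 2 then b else 0 else 0)" for i j
  have sum_v: "(\<Sum>i=1..n. v i) = k n"
  proof -
    have "{1..n} = insert n (insert (n - 1) {1..n - 2})"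
      "n \<notin> insert (n - 1) {1..n - 2}" "n - 1 \<notin> {1..n - 2}"
      using n by auto
    then have "(\<Sum>i=1..n. v i) = v n + (v (n - 1) + (\<Sum>i=1..n - 2. v i))"
      by (metis finite_atLeastAtMost finite_insert sum.insert)
    moreover have "(\<Sum>i=1..n - 2. v i) = (\<Sum>i=1..n - 2. r i)"
      by (intro sum.cong) (auto simp: v_def)
    moreover have "v n = d" "v (n - 1) = c"
      using n by (auto simp: v_def)
    ultimately show ?thesis
      by (simp add: c_def)
  qed
  have col: "(\<Sum>i=1..n. M i j) = s" if j: "j \<in> {1..n}" for j
  proof -
    have "(\<Sum>i=1..n. M i j) = (\<Sum>i=1..n. f i j) + (if j = n then k n else 0) + w j
        + (if j = 2 then a else 0) + (if j = n - 2 then b else 0)"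
      using n j sum_v by (auto simp: M_def sum.distrib sum.delta)
    also have "\<dots> = s"
      using n j by (auto simp: w_def k_def)
    finally show ?thesis .
  qed
  have row': "(\<Sum>j=1..n. M i j) = s" if i: "i \<in> {1..n - 1}" for i
  proof -
    have "i \<noteq> n" "n - Suc 0 \<noteq> n"
      using i n by auto
    then have "(\<Sum>j=1..n. M i j) = (\<Sum>j=1..n. f i j) + v i + (if i = n - 1 then a + b else 0)"
      using n i by (auto simp: M_def sum.distrib sum.delta)
    also have "\<dots> = s"
      using n i by (auto simp: v_def r_def b_def)
    finally show ?thesis .
  qed
  \<comment> \<open>double counting: the columns and the first \<open>n - 1\<close> rows force the last row\<close>
  have row_n: "(\<Sum>j=1..n. M n j) = s"
  proof -
    have split: "{1..n} = insert n {1..n - 1}"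
      using n by auto
    have "(\<Sum>i=1..n. \<Sum>j=1..n. M i j) = (\<Sum>j=1..n. M n j) + (\<Sum>i=1..n - 1. \<Sum>j=1..n. M i j)"
      using n by (subst split) simp
    also have "(\<Sum>i=1..n - 1. \<Sum>j=1..n. M i j) = int (n - 1) * s"
      using row' by simp
    finally have "(\<Sum>i=1..n. \<Sum>j=1..n. M i j) = (\<Sum>j=1..n. M n j) + int (n - 1) * s" .
    moreover have "(\<Sum>i=1..n. \<Sum>j=1..n. M i j) = int n * s"
      using col by (subst sum.swap) simp
    moreover have "int n * s = int (n - 1) * s + s"
      using n by (simp add: of_nat_diff algebra_simps)
    ultimately show ?thesis
      by linarith
  qed
  have row: "(\<Sum>j=1..n. M i j) = s" if "i \<in> {1..n}" for i
    using that row' row_n by (cases "i = n") auto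
  have diag: "(\<Sum>i=1..n. M i i) = s"
  proof -
    have "(\<Sum>i=1..n. M i i) = (\<Sum>i=1..n. f i i + (if i = n then d else 0))"
      using n by (intro sum.cong) (auto simp: M_def v_def w_def)
    then show ?thesis
      using n by (simp add: sum.distrib sum.delta d_def)
  qed
  have "r 1 = 0"
    by (simp add: r_def s_def)
  then have v1: "v 1 = 0"
    using n by (simp add: v_def)
  have anti: "(\<Sum>i=1..n. M i (n + 1 - i)) = s"
  proof -
    have "(\<Sum>i=1..n. M i (n + 1 - i)) = (\<Sum>i=1..n. f i (n + 1 - i)
        + (if i = n then k 1 else 0) + (if i = n - 1 then a else 0))"
    proof (intro sum.cong refl)
      fix i assume i: "i \<in> {1..n}"
      have w1: "w 1 = k 1"
        using n by (auto simp: w_def)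
      have eqs: "n + 1 - i = n \<longleftrightarrow> i = 1" "n + 1 - i = 2 \<longleftrightarrow> i = n - 1"
        using n i by auto
      show "M i (n + 1 - i) = f i (n + 1 - i)
        + (if i = n then k 1 else 0) + (if i = n - 1 then a else 0)"
        unfolding M_def eqs using n v1 w1 by auto
    qed
    then show ?thesis
      using n by (auto simp: sum.distrib sum.delta a_def)
  qed
  have "M i j = 0" if "\<not> (i \<in> {1..n} \<and> j \<in> {1..n})" for i j
  proof -
    have "f i j = 0"
      using that n by (auto simp: f_def skeleton_iff)
    then show ?thesis
      using that n by (auto simp: M_def v_def w_def)
  qed
  then have "magic_with_sum n s M"
    using row col diag anti by (simp add: magic_with_sum_def)
  then have "M \<in> magic_squares n"
    by (auto simp: mem_magic_squares_iff)
  moreover have "M i j = g i j" if "(i, j) \<in> skeleton n" for i j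
  proof -
    have "M i j = f i j"
      \<comment> \<open>the only position of the skeleton in the last column is \<open>(1, n)\<close>, where \<open>v\<close> vanishes\<close>
      using that n v1 by (auto simp: skeleton_iff M_def)
    then show ?thesis
      using that by (simp add: f_def)
  qed
  ultimately show thesis
    by (rule that)
qed

section \<open>The elephant basis\<close>

lemma elephant_basis_cases:
  assumes "M \<in> elephant_basis n"
  obtains i j where "(i, j) \<in> skeleton n"
    "\<forall>k l. (k, l) \<in> skeleton n \<longrightarrow> M k l = (if (k, l) = (i, j) then 1 else 0)"
  using assms unfolding elephant_basis_def by fastforce

text \<open>
  Evaluating a linear combination at the position of one basis element returns the coefficient
  of that element: another element with the same position would have the same entries on the
  skeleton and hence be the same square.
\<close>

lemma independent_elephant_basis:
  assumes n: "n \<ge> 5"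
  shows "int_square.independent (elephant_basis n)"
  unfolding int_square.dependent_explicit
proof clarify
  fix t u M
  assume t: "finite t" "t \<subseteq> elephant_basis n" and lin: "(\<Sum>N\<in>t. int_scale (u N) N) = 0"
    and M: "M \<in> t" and u: "u M \<noteq> 0"
  obtain i j where ij: "(i, j) \<in> skeleton n"
    "\<forall>k l. (k, l) \<in> skeleton n \<longrightarrow> M k l = (if (k, l) = (i, j) then 1 else 0)"
    by (rule elephant_basis_cases[OF subsetD[OF t(2) M]])
  have others: "N i j = 0" if N: "N \<in> t" "N \<noteq> M" for N
  proof (rule ccontr)
    assume "N i j \<noteq> 0"
    obtain i' j' where ij': "(i', j') \<in> skeleton n"
      "\<forall>k l. (k, l) \<in> skeleton n \<longrightarrow> N k l = (if (k, l) = (i', j') then 1 else 0)"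
      by (rule elephant_basis_cases[OF subsetD[OF t(2) N(1)]])
    with \<open>N i j \<noteq> 0\<close> ij(1) have "(i', j') = (i, j)"
      by metis
    then have "(N - M) k l = 0" if "(k, l) \<in> skeleton n" for k l
      using ij(2) ij'(2) that by simp
    moreover have "N - M \<in> magic_squares n"
      using N M t by (intro int_square.subspace_diff[OF subspace_magic_squares])
        (auto simp: elephant_basis_def)
    ultimately have "N - M = 0"
      using n by (intro magic_square_eq_0_if_zero_on_skeleton) auto
    with N show False
      by simp
  qed
  have "0 = (\<Sum>N\<in>t. int_scale (u N) N) i j"
    using lin by simp
  also have "\<dots> = (\<Sum>N\<in>t. if N = M then u M else 0)"
    unfolding sum_int_square_apply using ij others
    by (intro sum.cong) (auto simp: int_scale_def)
  also have "\<dots> = u M"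
    using t M by simp
  finally show False
    using u by simp
qed

text \<open>
  A magic square and the combination of basis elements whose coefficients are its skeleton
  entries agree on the skeleton, hence everywhere.
\<close>

lemma magic_squares_subset_span_elephant_basis:
  assumes n: "n \<ge> 5"
  shows "magic_squares n \<subseteq> int_square.span (elephant_basis n)"
proof
  fix M assume M: "M \<in> magic_squares n"
  have "\<exists>E. E \<in> magic_squares n \<and>
      (\<forall>k l. (k, l) \<in> skeleton n \<longrightarrow> E k l = (if (k, l) = p then 1 else 0))" for p
    using magic_square_with_prescribed_skeleton[OF n, of "\<lambda>k l. if (k, l) = p then 1 else 0"]
    by metis
  then obtain e where e_magic: "\<And>p. e p \<in> magic_squares n"
    and e: "\<And>p k l. (k, l) \<in> skeleton n \<Longrightarrow> e p k l = (if (k, l) = p then 1 else 0)"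
    by metis
  have e_basis: "e p \<in> elephant_basis n" if "p \<in> skeleton n" for p
  proof -
    obtain i j where p: "p = (i, j)"
      by (cases p)
    have "e p i j = 1" "\<And>k l. (k, l) \<in> skeleton n \<Longrightarrow> (k, l) \<noteq> (i, j) \<Longrightarrow> e p k l = 0"
      using that e p by auto
    then show ?thesis
      using that e_magic p unfolding elephant_basis_def by blast
  qed
  define L where "L = (\<Sum>p\<in>skeleton n. int_scale (M (fst p) (snd p)) (e p))"
  have fin: "finite (skeleton n)"
    by (simp add: skeleton_def)
  have "M - L \<in> magic_squares n"
    unfolding L_def using M e_magic subspace_magic_squares
    by (intro int_square.subspace_diff int_square.subspace_sum int_square.subspace_scale)
  moreover have "(M - L) k l = 0" if kl: "(k, l) \<in> skeleton n" for k l
  proof -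
    have "L k l = (\<Sum>p\<in>skeleton n. if p = (k, l) then M k l else 0)"
      unfolding L_def sum_int_square_apply using kl
      by (intro sum.cong) (auto simp: int_scale_def e)
    also have "\<dots> = M k l"
      using fin kl by simp
    finally show ?thesis
      by simp
  qed
  ultimately have "M - L = 0"
    using n by (intro magic_square_eq_0_if_zero_on_skeleton)
  moreover have "L \<in> int_square.span (elephant_basis n)"
    unfolding L_def using e_basis
    by (intro int_square.span_sum int_square.span_scale int_square.span_base)
  ultimately show "M \<in> int_square.span (elephant_basis n)"
    by simp
qed

theorem lemma3:
  fixes n :: nat
  assumes "n \<ge> 5"
  shows "is_Z_basis n (elephant_basis n)"
  using independent_elephant_basis[OF assms] magic_squares_subset_span_elephant_basis[OF assms]
  by (auto simp: is_Z_basis_def elephant_basis_def)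

end
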